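(* Let $\lambda_j$ be a non-real scaled $\ell$-th root of unity, i.e. $j\in\{2,\dots,\ell/2\}\cup\{\ell/2+2,\dots,\ell\}$, and let $B_j=A-\lambda_j I_N$. Let $\rho(\lambda_j)$ denote the asymptotic convergence factor of Chebyshev semi-iteration applied to $B_j$ with endpoints $[\xi_j^{(N)},\xi_j^{(1)}]$, and let $\rho(\Re(\lambda_j))$ denote the asymptotic convergence factor of Chebyshev semi-iteration applied to $\Re(B_j)=A-\Re(\lambda_j)I_N$ with endpoints $[\mu_N-\Re(\lambda_j),\mu_1-\Re(\lambda_j)]$. Then $$\rho(\lambda_j)<\rho(\Re(\lambda_j))=\sigma_j,\qquad \sigma_j=\frac{\sqrt{\kappa(\Re(B_j))}-1}{\sqrt{\kappa(\Re(B_j))}+1},$$ where $\kappa(\Re(B_j))=\dfrac{\mu_1-\Re(\lambda_j)}{\mu_N-\Re(\lambda_j)}$ is the (spectral) condition number of the symmetric positive definite matrix $\Re(B_j)$.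
   Context: $A\in\mathbb{R}^{N\times N}$ is symmetric positive definite with eigenvalues $\mu_1\ge\dots\ge\mu_N>0$ and $\mu_1>\mu_N$; $\ell>2$ is an even integer; $0<\alpha<\mu_N^\ell$. The scaled $\ell$-th roots of unity are $\lambda_j=\alpha^{1/\ell}\exp(2\pi i(j-1)/\ell)$, $j=1,\dots,\ell$. For a complex number $\lambda$ with $\Re(\lambda)<\mu_N$, the matrix $A-\lambda I_N$ has eigenvalues $\xi^{(k)}=\mu_k-\lambda$, $k=1,\dots,N$ (for $\lambda=\lambda_j$ these are denoted $\xi_j^{(k)}$); they lie on the line segment $[\xi^{(N)},\xi^{(1)}]=\{(1-t)\xi^{(N)}+t\xi^{(1)}:t\in[0,1]\}\subset\mathbb{C}$ parallel to the real axis. $T_p$ is the degree-$p$ Chebyshev polynomial of the first kind. Chebyshev semi-iteration applied to $A-\lambda I_N$ with endpoints $[\xi^{(N)},\xi^{(1)}]$ is the polynomial iterative method whose error after $p$ iterations is $e_p=\Omega_p(A-\lambda I_N)e_0$, with $$\Omega_p(z)=T_p\!\left(\frac{\xi^{(1)}+\xi^{(N)}-2z}{\xi^{(1)}-\xi^{(N)}}\right)\Big/T_p\!\left(\frac{\xi^{(1)}+\xi^{(N)}}{\xi^{(1)}-\xi^{(N)}}\right).$$ Its asymptotic convergence factor is $$\rho(\lambda)=\lim_{p\to\infty}\Big\{\max_{z\in[\xi^{(N)},\xi^{(1)}]}|\Omega_p(z)|\Big\}^{1/p}.$$ *)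

theory Defs
  imports "HOL-Analysis.Analysis" "HOL-Computational_Algebra.Polynomial"
begin

definition sym_pos_def :: "real^'n^'n \<Rightarrow> bool" where
  "sym_pos_def A \<longleftrightarrow> transpose A = A \<and> (\<forall>x. x \<noteq> 0 \<longrightarrow> 0 < x \<bullet> (A *v x))"

text \<open>The values \<open>mu 1, \<dots>, mu N\<close> with \<open>N = CARD('n)\<close> are the eigenvalues of \<open>A\<close>, counted with
  algebraic multiplicity (they split the characteristic polynomial) and listed in
  non-increasing order. Values of \<open>mu\<close> outside \<open>{1..N}\<close> are irrelevant.\<close>

definition eigenvalues_desc :: "real^'n^'n \<Rightarrow> (nat \<Rightarrow> real) \<Rightarrow> bool" where
  "eigenvalues_desc A mu \<longleftrightarrow>
     (\<forall>x. det (mat x - A) = (\<Prod>k=1..CARD('n). x - mu k)) \<and>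
     (\<forall>j k. 1 \<le> j \<and> j \<le> k \<and> k \<le> CARD('n) \<longrightarrow> mu k \<le> mu j)"

definition scaled_root :: "nat \<Rightarrow> real \<Rightarrow> nat \<Rightarrow> complex" where
  "scaled_root l \<alpha> j =
     of_real (\<alpha> powr (1 / real l)) * exp (2 * of_real pi * \<i> * (of_nat j - 1) / of_nat l)"

definition shifted :: "real^'n^'n \<Rightarrow> complex \<Rightarrow> complex^'n^'n" where
  "shifted A lam = (\<chi> i k. complex_of_real (A $ i $ k)) - mat lam"

definition Re_matrix :: "complex^'n^'m \<Rightarrow> real^'n^'m" where
  "Re_matrix B = (\<chi> i k. Re (B $ i $ k))"

definition spectral_cond :: "real^'n^'n \<Rightarrow> real" where
  "spectral_cond M = onorm ((*v) M) * onorm ((*v) (matrix_inv M))"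

fun cheb :: "nat \<Rightarrow> 'a::comm_ring_1 poly" where
  "cheb 0 = 1"
| "cheb (Suc 0) = [:0, 1:]"
| "cheb (Suc (Suc p)) = [:0, 2:] * cheb (Suc p) - cheb p"

text \<open>Chebyshev semi-iteration for a matrix \<open>B\<close> with endpoints \<open>a\<close>, \<open>b\<close> has the error
  \<open>e\<^sub>p = \<Omega>\<^sub>p(B) e\<^sub>0\<close> for the following residual polynomial \<open>\<Omega>\<^sub>p\<close>.\<close>

definition cheb_residual :: "complex \<Rightarrow> complex \<Rightarrow> nat \<Rightarrow> complex \<Rightarrow> complex" where
  "cheb_residual a b p z =
     poly (cheb p) ((b + a - 2 * z) / (b - a)) / poly (cheb p) ((b + a) / (b - a))"

text \<open>The supremum is a maximum, since \<open>cheb_residual a b p\<close> is continuous and the segment is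
  compact. The entry at \<open>p = 0\<close> is \<open>root 0 _ = 0\<close> and does not affect the limit.\<close>

definition conv_seq :: "complex \<Rightarrow> complex \<Rightarrow> nat \<Rightarrow> real" where
  "conv_seq a b p = root p (SUP z\<in>closed_segment a b. cmod (cheb_residual a b p z))"

definition conv_factor :: "complex \<Rightarrow> complex \<Rightarrow> real" where
  "conv_factor a b = lim (conv_seq a b)"

end

theory Submission
  imports Defs
begin

text \<open>
  The Joukowski map carries the convergence theory. If \<open>w = (v + 1/v)/2\<close> then
  \<open>T\<^sub>p(w) = (v\<^sup>p + v\<^sup>-\<^sup>p)/2\<close> (\<open>poly_cheb_Joukowski\<close>). On the segment between the endpoints the
  argument of the numerator of \<open>\<Omega>\<^sub>p\<close> runs through \<open>[-1,1]\<close>, where \<open>|T\<^sub>p| \<le> 1\<close>, with the value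
  \<open>1\<close> at an endpoint. The maximum of \<open>|\<Omega>\<^sub>p|\<close> is therefore exactly \<open>1/|T\<^sub>p(w)|\<close> with
  \<open>w = (b + a)/(b - a)\<close>, and its \<open>p\<close>-th root tends to \<open>1/|v|\<close>, where \<open>v\<close> is the preimage of \<open>w\<close>
  outside the unit disc (\<open>conv_seq_LIMSEQ\<close>).

  Passing from \<open>\<Re>(\<lambda>)\<close> to \<open>\<lambda>\<close> moves the real point \<open>w > 1\<close> vertically off the real axis. The
  circle \<open>|v| = R\<close> corresponds to the ellipse with foci \<open>1\<close> and \<open>-1\<close> on which
  \<open>|w - 1| + |w + 1| = R + 1/R\<close> (\<open>Joukowski_focal_sum\<close>). A vertical move strictly increases both
  focal distances, hence also \<open>R\<close>, so the convergence factor drops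
  (\<open>Joukowski_vertical_shift\<close>). For real \<open>\<lambda>\<close> the preimage is
  \<open>(\<surd>\<kappa> + 1)/(\<surd>\<kappa> - 1)\<close>, which gives the value \<open>\<sigma>\<close>.

  It remains to identify \<open>\<kappa>\<close> with a quotient of eigenvalues. The extreme values of the Rayleigh
  quotient of a symmetric matrix are eigenvalues, so they are bracketed by the extreme roots
  of the characteristic polynomial; for a positive definite matrix these bounds give the
  operator norms of the matrix and of its inverse (\<open>spectral_cond_Rayleigh\<close>).
\<close>

section \<open>Symmetric matrices and Rayleigh bounds\<close>

lemma inner_matrix_vector_symmetric:
  fixes M :: "real^'n^'n"
  assumes "transpose M = M"
  shows "x \<bullet> (M *v y) = (M *v x) \<bullet> y"
  using assms by (metis dot_lmul_matrix transpose_matrix_vector)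

text \<open>The quadratic form at \<open>x + t y\<close> is a nonnegative quadratic polynomial in \<open>t\<close>, so its
  discriminant is at most zero. For a singular form the inequality turns a zero of the quadratic
  form into a kernel vector of the matrix.\<close>

lemma psd_Cauchy_Schwarz:
  fixes M :: "real^'n^'n"
  assumes sym: "transpose M = M" and psd: "\<And>x. 0 \<le> x \<bullet> (M *v x)"
  shows "(x \<bullet> (M *v y))\<^sup>2 \<le> (x \<bullet> (M *v x)) * (y \<bullet> (M *v y))"
proof -
  define a b c where "a = x \<bullet> (M *v x)" and "b = y \<bullet> (M *v y)" and "c = x \<bullet> (M *v y)"
  have yx: "y \<bullet> (M *v x) = c"
    unfolding c_def by (metis inner_matrix_vector_symmetric[OF sym] inner_commute)
  have q: "0 \<le> a + 2 * t * c + t\<^sup>2 * b" for t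
  proof -
    have "a + 2 * t * c + t\<^sup>2 * b = (x + t *\<^sub>R y) \<bullet> (M *v (x + t *\<^sub>R y))"
      using yx unfolding a_def b_def c_def
      by (simp add: matrix_vector_right_distrib matrix_vector_mult_scaleR inner_add_left
          inner_add_right algebra_simps power2_eq_square)
    then show ?thesis using psd by simp
  qed
  have "c\<^sup>2 \<le> a * b"
  proof (cases "b = 0")
    case True
    have "c = 0"
    proof (rule ccontr)
      assume "c \<noteq> 0"
      \<comment> \<open>At this \<open>t\<close> the now affine function of \<open>t\<close> takes the value \<open>-1\<close>.\<close>
      then show False using q[of "- (a + 1) / (2 * c)"] True by (simp add: field_simps)
    qed
    then show ?thesis using True by simp
  next
    case False
    then have "b > 0" using psd[of y] unfolding b_def by simp
    then show ?thesis
      using q[of "- c / b"] by (simp add: field_simps power2_eq_square)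
  qed
  then show ?thesis unfolding a_def b_def c_def .
qed

lemma mat_diff_vector:
  fixes A :: "real^'n^'n"
  shows "(mat c - A) *v x = c *\<^sub>R x - A *v x"
    and "(A - mat c) *v x = A *v x - c *\<^sub>R x"
proof -
  have "mat c *v x = c *\<^sub>R x"
    by (vector matrix_vector_mult_def mat_def) (simp add: if_distrib[of "\<lambda>u. u * _"] cong: if_cong)
  then show "(mat c - A) *v x = c *\<^sub>R x - A *v x" "(A - mat c) *v x = A *v x - c *\<^sub>R x"
    by (simp_all add: matrix_vector_mult_diff_rdistrib)
qed

lemma transpose_mat_diff:
  fixes A :: "real^'n^'n"
  assumes "transpose A = A"
  shows "transpose (mat c - A) = mat c - A" "transpose (A - mat c) = A - mat c"
proof -
  have A: "A $ k $ i = A $ i $ k" for i k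
    using arg_cong[OF assms, of "\<lambda>M. M $ i $ k"] by (simp add: transpose_def)
  show "transpose (mat c - A) = mat c - A" "transpose (A - mat c) = A - mat c"
    unfolding vec_eq_iff transpose_def mat_def by (simp_all add: A)
qed

lemma det_eq_0_iff_eigenvector:
  fixes A :: "real^'n^'n"
  shows "det (mat c - A) = 0 \<longleftrightarrow> (\<exists>v. v \<noteq> 0 \<and> A *v v = c *\<^sub>R v)"
proof -
  have "det (mat c - A) \<noteq> 0 \<longleftrightarrow> (\<forall>v. (mat c - A) *v v = 0 \<longrightarrow> v = 0)"
    by (metis invertible_det_nz invertible_left_inverse matrix_left_invertible_ker)
  then show ?thesis
    unfolding mat_diff_vector by (metis eq_iff_diff_eq_0)
qed

text \<open>Let \<open>v\<close> maximise the quadratic form on the unit sphere, with maximum \<open>L\<close>. Then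
  \<open>P = L I - A\<close> is positive semidefinite and its form vanishes at \<open>v\<close>. By Cauchy-Schwarz for
  the form of \<open>P\<close>, it follows that \<open>P v = 0\<close>.\<close>

lemma Rayleigh_upper_bound_eigenvalue:
  fixes A :: "real^'n^'n"
  assumes sym: "transpose A = A"
  obtains L v where "v \<noteq> 0" "A *v v = L *\<^sub>R v" "\<And>x. x \<bullet> (A *v x) \<le> L * (norm x)\<^sup>2"
proof -
  have "continuous_on (sphere 0 1) (\<lambda>x. x \<bullet> (A *v x))"
    by (intro continuous_intros linear_continuous_on) (simp add: linear_linear)
  moreover have "sphere (0::real^'n) 1 \<noteq> {}" by simp
  ultimately obtain v where v: "v \<in> sphere 0 1"
    and max: "\<And>y. y \<in> sphere 0 1 \<Longrightarrow> y \<bullet> (A *v y) \<le> v \<bullet> (A *v v)"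
    using continuous_attains_sup[of "sphere 0 1" "\<lambda>x. x \<bullet> (A *v x)"] compact_sphere by blast
  define L where "L = v \<bullet> (A *v v)"
  have bound: "x \<bullet> (A *v x) \<le> L * (norm x)\<^sup>2" for x
  proof (cases "x = 0")
    case False
    define y where "y = x /\<^sub>R norm x"
    have "x = norm x *\<^sub>R y" "y \<in> sphere 0 1" using False by (simp_all add: y_def)
    have "x \<bullet> (A *v x) = (norm x)\<^sup>2 * (y \<bullet> (A *v y))"
      by (subst (1 2) \<open>x = norm x *\<^sub>R y\<close>) (simp add: matrix_vector_mult_scaleR power2_eq_square)
    also have "\<dots> \<le> (norm x)\<^sup>2 * L"
      using max[OF \<open>y \<in> sphere 0 1\<close>] unfolding L_def by (intro mult_left_mono) auto
    finally show ?thesis by (simp add: mult.commute)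
  qed simp
  define P where "P = mat L - A"
  have symP: "transpose P = P" unfolding P_def by (rule transpose_mat_diff(1)[OF sym])
  have quadP: "x \<bullet> (P *v x) = L * (norm x)\<^sup>2 - x \<bullet> (A *v x)" for x
    by (simp add: P_def mat_diff_vector inner_diff_right power2_norm_eq_inner)
  have "v \<bullet> (P *v v) = 0" using v by (simp add: quadP L_def)
  moreover have "((P *v v) \<bullet> (P *v v))\<^sup>2 \<le> ((P *v v) \<bullet> (P *v (P *v v))) * (v \<bullet> (P *v v))"
    by (rule psd_Cauchy_Schwarz[OF symP]) (use bound quadP in simp)
  ultimately have "P *v v = 0" by simp
  then have "A *v v = L *\<^sub>R v" by (simp add: P_def mat_diff_vector)
  moreover have "v \<noteq> 0" using v by auto
  ultimately show thesis using that bound by blast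
qed

lemma Rayleigh_lower_bound_eigenvalue:
  fixes A :: "real^'n^'n"
  assumes sym: "transpose A = A"
  obtains L v where "v \<noteq> 0" "A *v v = L *\<^sub>R v" "\<And>x. L * (norm x)\<^sup>2 \<le> x \<bullet> (A *v x)"
proof -
  have neg: "(- A) *v x = - (A *v x)" for x
    using matrix_vector_mult_diff_rdistrib[of 0 A x] by simp
  have "transpose (- A) = - A" using sym by (simp add: transpose_def vec_eq_iff)
  then obtain L v where *: "v \<noteq> 0" "(- A) *v v = L *\<^sub>R v"
    and b: "\<And>x. x \<bullet> ((- A) *v x) \<le> L * (norm x)\<^sup>2"
    by (rule Rayleigh_upper_bound_eigenvalue) blast
  show thesis
  proof (rule that)
    show "v \<noteq> 0" by fact
    show "A *v v = (- L) *\<^sub>R v" using arg_cong[OF *(2), of uminus] by (simp add: neg)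
    show "(- L) * (norm x)\<^sup>2 \<le> x \<bullet> (A *v x)" for x using b[of x] by (simp add: neg)
  qed
qed

lemma eigenvalues_desc_iff_eigenvector:
  fixes A :: "real^'n^'n"
  assumes "eigenvalues_desc A mu"
  shows "(\<exists>v. v \<noteq> 0 \<and> A *v v = c *\<^sub>R v) \<longleftrightarrow> c \<in> mu ` {1..CARD('n)}"
proof -
  have "det (mat c - A) = (\<Prod>k=1..CARD('n). c - mu k)"
    using assms unfolding eigenvalues_desc_def by blast
  then have "det (mat c - A) = 0 \<longleftrightarrow> (\<exists>k\<in>{1..CARD('n)}. c - mu k = 0)"
    by (simp add: prod_zero_iff)
  then show ?thesis unfolding det_eq_0_iff_eigenvector by auto
qed

text \<open>The sharp Rayleigh bounds are eigenvalues, hence occur among the \<open>mu k\<close>, and so lie between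
  the last and the first of these. This replaces a diagonalisation of \<open>A\<close>.\<close>

lemma eigenvalues_desc_Rayleigh_bounds:
  fixes A :: "real^'n^'n"
  assumes sym: "transpose A = A" and ev: "eigenvalues_desc A mu"
  shows "mu (CARD('n)) * (norm x)\<^sup>2 \<le> x \<bullet> (A *v x)" "x \<bullet> (A *v x) \<le> mu 1 * (norm x)\<^sup>2"
proof -
  note eig = eigenvalues_desc_iff_eigenvector[OF ev]
  have ord: "1 \<le> j \<Longrightarrow> j \<le> k \<Longrightarrow> k \<le> CARD('n) \<Longrightarrow> mu k \<le> mu j" for j k
    using ev unfolding eigenvalues_desc_def by blast
  obtain L v where "v \<noteq> 0" "A *v v = L *\<^sub>R v" and b: "\<And>x. x \<bullet> (A *v x) \<le> L * (norm x)\<^sup>2"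
    using Rayleigh_upper_bound_eigenvalue[OF sym] by metis
  then have "L \<in> mu ` {1..CARD('n)}" using eig by blast
  then have "L \<le> mu 1" using ord by auto
  then have "L * (norm x)\<^sup>2 \<le> mu 1 * (norm x)\<^sup>2" by (intro mult_right_mono) auto
  then show "x \<bullet> (A *v x) \<le> mu 1 * (norm x)\<^sup>2" using b[of x] by linarith
  obtain L' v' where "v' \<noteq> 0" "A *v v' = L' *\<^sub>R v'"
    and b': "\<And>x. L' * (norm x)\<^sup>2 \<le> x \<bullet> (A *v x)"
    using Rayleigh_lower_bound_eigenvalue[OF sym] by metis
  then have "L' \<in> mu ` {1..CARD('n)}" using eig by blast
  then have "mu (CARD('n)) \<le> L'" using ord by auto
  then have "mu (CARD('n)) * (norm x)\<^sup>2 \<le> L' * (norm x)\<^sup>2" by (intro mult_right_mono) auto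
  then show "mu (CARD('n)) * (norm x)\<^sup>2 \<le> x \<bullet> (A *v x)" using b'[of x] by linarith
qed

section \<open>The spectral condition number\<close>

lemma onorm_eqI_attained:
  fixes f :: "'a::real_normed_vector \<Rightarrow> 'b::real_normed_vector"
  assumes "bounded_linear f" "\<And>x. norm (f x) \<le> K * norm x" "v \<noteq> 0" "norm (f v) = K * norm v"
  shows "onorm f = K"
proof (rule antisym)
  have K: "K = norm (f v) / norm v" using assms(3,4) by simp
  then have "0 \<le> K" by simp
  then show "onorm f \<le> K" using assms(2) by (rule onorm_bound)
  show "K \<le> onorm f" unfolding K by (rule le_onorm[OF assms(1)])
qed

text \<open>The bound \<open>\<bar>M x\<bar> \<le> K \<bar>x\<bar>\<close> comes from Cauchy-Schwarz for the form of \<open>M\<close> at \<open>M x\<close> and \<open>x\<close>,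
  and \<open>m \<bar>x\<bar> \<le> \<bar>M x\<bar>\<close>, which bounds the inverse, from ordinary Cauchy-Schwarz. The eigenvectors
  show that both bounds are attained.\<close>

lemma spectral_cond_Rayleigh:
  fixes M :: "real^'n^'n"
  assumes sym: "transpose M = M" and "0 < m"
    and lo: "\<And>x. m * (norm x)\<^sup>2 \<le> x \<bullet> (M *v x)"
    and up: "\<And>x. x \<bullet> (M *v x) \<le> K * (norm x)\<^sup>2"
    and u: "u \<noteq> 0" "M *v u = m *\<^sub>R u" and v: "v \<noteq> 0" "M *v v = K *\<^sub>R v"
  shows "spectral_cond M = K / m"
proof -
  have lower: "m * norm x \<le> norm (M *v x)" for x
  proof (cases "x = 0")
    case False
    have "m * (norm x)\<^sup>2 \<le> norm x * norm (M *v x)"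
      using lo[of x] norm_cauchy_schwarz[of x "M *v x"] by linarith
    then have "norm x * (m * norm x) \<le> norm x * norm (M *v x)"
      by (simp add: power2_eq_square mult_ac)
    then show ?thesis using False by simp
  qed simp
  have psd: "0 \<le> x \<bullet> (M *v x)" for x
    using lo[of x] \<open>0 < m\<close> by (smt (verit) mult_nonneg_nonneg zero_le_power2)
  have "0 < K"
  proof -
    have "m * (norm v)\<^sup>2 \<le> K * (norm v)\<^sup>2" using lo[of v] up[of v] by linarith
    then show ?thesis using v(1) \<open>0 < m\<close> by simp
  qed
  have upper: "norm (M *v x) \<le> K * norm x" for x
  proof (cases "M *v x = 0")
    case True
    then show ?thesis using \<open>0 < K\<close> by simp
  next
    case False
    let ?y = "M *v x"
    have "(?y \<bullet> (M *v x))\<^sup>2 \<le> (?y \<bullet> (M *v ?y)) * (x \<bullet> (M *v x))"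
      by (rule psd_Cauchy_Schwarz[OF sym psd])
    also have "\<dots> \<le> (K * (norm ?y)\<^sup>2) * (K * (norm x)\<^sup>2)"
      using \<open>0 < K\<close> by (intro mult_mono up psd) auto
    finally have "(norm ?y)\<^sup>2 * (norm ?y)\<^sup>2 \<le> (norm ?y)\<^sup>2 * (K * norm x)\<^sup>2"
      by (simp add: power2_norm_eq_inner[symmetric] power2_eq_square mult_ac)
    moreover have "0 < (norm ?y)\<^sup>2" using False by simp
    ultimately have "(norm ?y)\<^sup>2 \<le> (K * norm x)\<^sup>2" by (rule mult_left_le_imp_le)
    then show ?thesis using \<open>0 < K\<close> by (meson less_imp_le mult_nonneg_nonneg norm_ge_zero power2_le_imp_le)
  qed
  have bl: "bounded_linear ((*v) C)" for C :: "real^'n^'n"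
    by (simp add: linear_linear)
  have "onorm ((*v) M) = K"
    by (rule onorm_eqI_attained[OF bl upper v(1)]) (use v(2) \<open>0 < K\<close> in simp)
  moreover have "onorm ((*v) (matrix_inv M)) = 1 / m"
  proof -
    have "\<forall>x. M *v x = 0 \<longrightarrow> x = 0" 
    proof (intro allI impI)
      fix x assume "M *v x = 0"
      then have "m * norm x \<le> 0" using lower[of x] by simp
      then show "x = 0" using \<open>0 < m\<close> by (simp add: mult_le_0_iff)
    qed
    then have "invertible M" by (metis invertible_left_inverse matrix_left_invertible_ker)
    then have inv: "M ** matrix_inv M = mat 1" "matrix_inv M ** M = mat 1"
      unfolding matrix_inv_def invertible_def by (metis (mono_tags, lifting) someI_ex)+
    have invx: "M *v (matrix_inv M *v x) = x" "matrix_inv M *v (M *v x) = x" for x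
      by (simp_all add: matrix_vector_mul_assoc inv)
    have "norm (matrix_inv M *v x) \<le> (1 / m) * norm x" for x
      using lower[of "matrix_inv M *v x"] \<open>0 < m\<close> by (simp add: invx field_simps)
    moreover have "norm (matrix_inv M *v u) = (1 / m) * norm u"
    proof -
      have "m *\<^sub>R (matrix_inv M *v u) = u"
        using invx(2)[of u] u(2) by (simp add: matrix_vector_mult_scaleR)
      then have "m * norm (matrix_inv M *v u) = norm u"
        using \<open>0 < m\<close> by (metis abs_of_pos norm_scaleR)
      then show ?thesis using \<open>0 < m\<close> by (simp add: field_simps)
    qed
    ultimately show ?thesis by (rule onorm_eqI_attained[OF bl _ u(1)])
  qed
  ultimately show ?thesis unfolding spectral_cond_def by simp
qed

lemma eigenvalues_desc_shift:
  fixes A :: "real^'n^'n"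
  assumes sym: "transpose A = A" and ev: "eigenvalues_desc A mu" and c: "c < mu (CARD('n))"
  shows "sym_pos_def (A - mat c)"
    and "spectral_cond (A - mat c) = (mu 1 - c) / (mu (CARD('n)) - c)"
proof -
  define M where "M = A - mat c"
  have symM: "transpose M = M" unfolding M_def by (rule transpose_mat_diff(2)[OF sym])
  have quad: "x \<bullet> (M *v x) = x \<bullet> (A *v x) - c * (norm x)\<^sup>2" for x
    by (simp add: M_def mat_diff_vector inner_diff_right power2_norm_eq_inner)
  have lo: "(mu (CARD('n)) - c) * (norm x)\<^sup>2 \<le> x \<bullet> (M *v x)" for x
    using eigenvalues_desc_Rayleigh_bounds(1)[OF sym ev, of x] by (simp add: quad algebra_simps)
  have up: "x \<bullet> (M *v x) \<le> (mu 1 - c) * (norm x)\<^sup>2" for x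
    using eigenvalues_desc_Rayleigh_bounds(2)[OF sym ev, of x] by (simp add: quad algebra_simps)
  have "0 < x \<bullet> (M *v x)" if "x \<noteq> 0" for x
    using lo[of x] c that by (smt (verit) mult_pos_pos zero_less_norm_iff zero_less_power)
  then show "sym_pos_def (A - mat c)" using symM unfolding sym_pos_def_def M_def by blast
  have N: "1 \<le> CARD('n)" by (simp add: Suc_le_eq)
  have ex: "\<exists>v. v \<noteq> 0 \<and> M *v v = (mu k - c) *\<^sub>R v" if k: "k \<in> {1..CARD('n)}" for k
  proof -
    obtain v where v: "v \<noteq> 0" "A *v v = mu k *\<^sub>R v"
      using eigenvalues_desc_iff_eigenvector[OF ev, of "mu k"] imageI[OF k, of mu] by metis
    have "M *v v = (mu k - c) *\<^sub>R v"
      unfolding M_def mat_diff_vector v(2) by (rule scaleR_left_diff_distrib[symmetric])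
    then show ?thesis using v(1) by blast
  qed
  obtain u where u: "u \<noteq> 0" "M *v u = (mu (CARD('n)) - c) *\<^sub>R u" using ex[of "CARD('n)"] N by auto
  obtain v where v: "v \<noteq> 0" "M *v v = (mu 1 - c) *\<^sub>R v" using ex[of 1] N by auto
  show "spectral_cond (A - mat c) = (mu 1 - c) / (mu (CARD('n)) - c)"
    using spectral_cond_Rayleigh[OF symM _ lo up u v] c unfolding M_def by simp
qed

section \<open>Chebyshev polynomials and the Joukowski map\<close>

lemma poly_cheb_Joukowski:
  fixes v :: complex
  assumes "v \<noteq> 0"
  shows "poly (cheb p) ((v + 1 / v) / 2) = (v ^ p + 1 / v ^ p) / 2"
proof (induction p rule: cheb.induct)
  case (3 p)
  have "poly (cheb (Suc (Suc p))) ((v + 1 / v) / 2)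
      = (v + 1 / v) * ((v ^ Suc p + 1 / v ^ Suc p) / 2) - (v ^ p + 1 / v ^ p) / 2"
    by (simp only: cheb.simps(3) poly_diff poly_mult 3) simp
  also have "\<dots> = (v ^ Suc (Suc p) + 1 / v ^ Suc (Suc p)) / 2"
    using assms by (simp add: field_simps)
  finally show ?case .
qed simp_all

text \<open>For \<open>x = cos \<theta>\<close> the point \<open>v = exp(i \<theta>)\<close> is a Joukowski preimage, so
  \<open>T\<^sub>p(x)\<close> is the mean of two unit complex numbers.\<close>

lemma cmod_cheb_le_1:
  assumes "\<bar>x\<bar> \<le> 1"
  shows "cmod (poly (cheb p) (of_real x)) \<le> 1"
proof -
  define u where "u = cis (arccos x)"
  have "u + 1 / u = 2 * of_real x"
    using assms by (simp add: u_def divide_inverse cis_inverse complex_eq_iff)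
  then have "(u + 1 / u) / 2 = of_real x" by simp
  then have "poly (cheb p) (of_real x) = (u ^ p + 1 / u ^ p) / 2"
    using poly_cheb_Joukowski[of u p] by (simp add: u_def)
  also have "cmod \<dots> \<le> (cmod (u ^ p) + cmod (1 / u ^ p)) / 2"
    using norm_triangle_ineq[of "u ^ p" "1 / u ^ p"] by (simp add: norm_divide)
  also have "\<dots> = 1" by (simp add: u_def norm_power norm_divide)
  finally show ?thesis .
qed

text \<open>The affine map \<open>z \<mapsto> (b + a - 2 z)/(b - a)\<close> sends the complex segment to the real interval
  \<open>[-1,1]\<close>, with \<open>a \<mapsto> 1\<close>, where \<open>T\<^sub>p\<close> attains its maximum modulus \<open>1\<close>.\<close>

lemma SUP_cheb_residual:
  assumes "a \<noteq> b"
  shows "(SUP z\<in>closed_segment a b. cmod (cheb_residual a b p z))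
    = 1 / cmod (poly (cheb p) ((b + a) / (b - a)))"
proof (rule cSup_eq_maximum)
  have "poly (cheb p) 1 = (1 :: complex)" using poly_cheb_Joukowski[of 1 p] by simp
  moreover have "(b + a - 2 * a) / (b - a) = 1" using assms by (simp add: field_simps)
  ultimately have "cmod (cheb_residual a b p a) = 1 / cmod (poly (cheb p) ((b + a) / (b - a)))"
    unfolding cheb_residual_def by (simp add: norm_divide)
  then show "1 / cmod (poly (cheb p) ((b + a) / (b - a)))
      \<in> (\<lambda>z. cmod (cheb_residual a b p z)) ` closed_segment a b"
    by (metis ends_in_segment(1) image_eqI)
next
  fix y assume "y \<in> (\<lambda>z. cmod (cheb_residual a b p z)) ` closed_segment a b"
  then obtain t where t: "0 \<le> t" "t \<le> 1"
    and y: "y = cmod (cheb_residual a b p ((1 - t) *\<^sub>R a + t *\<^sub>R b))"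
    by (auto simp: closed_segment_def)
  have "(b + a - 2 * ((1 - t) *\<^sub>R a + t *\<^sub>R b)) / (b - a) = of_real (1 - 2 * t)"
    using assms by (simp add: field_simps scaleR_conv_of_real)
  then have "y = cmod (poly (cheb p) (of_real (1 - 2 * t))) / cmod (poly (cheb p) ((b + a) / (b - a)))"
    unfolding y cheb_residual_def by (simp only: norm_divide)
  also have "\<dots> \<le> 1 / cmod (poly (cheb p) ((b + a) / (b - a)))"
    using t by (intro divide_right_mono cmod_cheb_le_1) auto
  finally show "y \<le> 1 / cmod (poly (cheb p) ((b + a) / (b - a)))" .
qed

text \<open>Once \<open>|v|\<^sup>p > 2\<close>, the term \<open>v\<^sup>-\<^sup>p\<close> is too small to matter: \<open>|T\<^sub>p|\<close> lies between
  \<open>|v|\<^sup>p/4\<close> and \<open>|v|\<^sup>p\<close>, and the \<open>p\<close>-th root of the constant tends to \<open>1\<close>.\<close>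

lemma root_cheb_Joukowski_LIMSEQ:
  fixes v :: complex
  assumes v: "1 < cmod v"
  shows "(\<lambda>p. root p (cmod (poly (cheb p) ((v + 1 / v) / 2)))) \<longlonglongrightarrow> cmod v"
proof -
  define r where "r = cmod v"
  have r: "1 < r" using v by (simp add: r_def)
  have v0: "v \<noteq> 0" using v by auto
  have T: "poly (cheb p) ((v + 1 / v) / 2) = (v ^ p + 1 / v ^ p) / 2" for p
    by (rule poly_cheb_Joukowski[OF v0])
  have small: "eventually (\<lambda>p. 2 < r ^ p) sequentially"
    using filterlim_realpow_sequentially_gt1[of r] r
    by (auto simp: filterlim_at_infinity_imp_norm_at_top filterlim_at_top_dense
        dest!: filterlim_at_infinity_imp_norm_at_top elim: eventually_mono)
  have bounds: "r ^ p / 4 \<le> cmod (poly (cheb p) ((v + 1 / v) / 2))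
      \<and> cmod (poly (cheb p) ((v + 1 / v) / 2)) \<le> r ^ p" if "2 < r ^ p" for p
  proof -
    have inv: "cmod (1 / v ^ p) \<le> 1 / 2" "cmod (v ^ p) = r ^ p"
      using that by (simp_all add: norm_divide norm_power r_def field_simps)
    have "cmod (poly (cheb p) ((v + 1 / v) / 2)) = cmod (v ^ p + 1 / v ^ p) / 2"
      unfolding T by (simp add: norm_divide)
    moreover have "cmod (v ^ p + 1 / v ^ p) \<le> r ^ p + 1 / 2"
      using norm_triangle_ineq[of "v ^ p" "1 / v ^ p"] inv by linarith
    moreover have "r ^ p - 1 / 2 \<le> cmod (v ^ p + 1 / v ^ p)"
      using norm_diff_ineq[of "v ^ p" "1 / v ^ p"] inv by linarith
    ultimately show ?thesis using that by linarith
  qed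
  have ev: "eventually (\<lambda>p. 0 < p \<and> 2 < r ^ p) sequentially"
    using small eventually_gt_at_top[of 0] by eventually_elim auto
  show ?thesis unfolding r_def[symmetric]
  proof (rule tendsto_sandwich)
    show "eventually (\<lambda>p. root p (1 / 4) * r \<le> root p (cmod (poly (cheb p) ((v + 1 / v) / 2)))) sequentially"
      using ev
    proof eventually_elim
      case (elim p)
      then have "root p (1 / 4) * r = root p (r ^ p / 4)"
        using r by (simp add: real_root_divide real_root_power_cancel)
      then show ?case using bounds[of p] elim by simp
    qed
    show "eventually (\<lambda>p. root p (cmod (poly (cheb p) ((v + 1 / v) / 2))) \<le> r) sequentially"
      using ev
    proof eventually_elim
      case (elim p)
      then have "root p (r ^ p) = r" using r by (simp add: real_root_power_cancel)
      then show ?case using bounds[of p] elim by (metis real_root_le_iff)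
    qed
    show "(\<lambda>p. root p (1 / 4) * r) \<longlonglongrightarrow> r"
      using tendsto_mult_right[OF LIMSEQ_root_const[of "1/4"], of r] by simp
  qed simp
qed

lemma conv_seq_LIMSEQ:
  fixes a b v :: complex
  assumes "a \<noteq> b" and v: "1 < cmod v" and "(b + a) / (b - a) = (v + 1 / v) / 2"
  shows "conv_seq a b \<longlonglongrightarrow> 1 / cmod v"
proof -
  have "conv_seq a b = (\<lambda>p. 1 / root p (cmod (poly (cheb p) ((v + 1 / v) / 2))))"
    unfolding fun_eq_iff conv_seq_def SUP_cheb_residual[OF assms(1)] assms(3) real_root_divide
  proof
    fix p
    \<comment> \<open>At \<open>p = 0\<close> both sides are \<open>0\<close>, since \<open>root 0 _ = 0\<close>.\<close>
    show "root p 1 / root p (cmod (poly (cheb p) ((v + 1 / v) / 2)))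
        = 1 / root p (cmod (poly (cheb p) ((v + 1 / v) / 2)))"
      by (cases "p = 0") simp_all
  qed
  moreover have "\<dots> \<longlonglongrightarrow> 1 / cmod v"
    by (intro tendsto_divide tendsto_const root_cheb_Joukowski_LIMSEQ v) (use v in auto)
  ultimately show ?thesis by simp
qed

text \<open>Both \<open>w - 1\<close> and \<open>w + 1\<close> are squares up to the factor \<open>2 v\<close>, and the parallelogram law
  evaluates \<open>|v - 1|\<^sup>2 + |v + 1|\<^sup>2\<close>. This is the classical fact that the Joukowski map sends
  circles about \<open>0\<close> to ellipses with foci \<open>1\<close> and \<open>-1\<close>.\<close>

lemma Joukowski_focal_sum:
  fixes v :: complex
  assumes "v \<noteq> 0" "w = (v + 1 / v) / 2"
  shows "cmod (w - 1) + cmod (w + 1) = cmod v + 1 / cmod v"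
proof -
  have "w - 1 = (v - 1)\<^sup>2 / (2 * v)" "w + 1 = (v + 1)\<^sup>2 / (2 * v)"
    using assms by (simp_all add: field_simps power2_eq_square)
  then have "cmod (w - 1) + cmod (w + 1) = ((cmod (v - 1))\<^sup>2 + (cmod (v + 1))\<^sup>2) / (2 * cmod v)"
    by (simp add: norm_divide norm_mult norm_power add_divide_distrib)
  also have "(cmod (v - 1))\<^sup>2 + (cmod (v + 1))\<^sup>2 = 2 * (cmod v)\<^sup>2 + 2"
    unfolding cmod_power2 by (simp add: power2_eq_square algebra_simps)
  finally show ?thesis using assms(1) by (simp add: field_simps power2_eq_square)
qed

text \<open>The two roots of \<open>v\<^sup>2 - 2 w v + 1\<close> are reciprocal, so one of them lies outside the open
  unit disc.\<close>

lemma Joukowski_preimage: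
  fixes w :: complex
  obtains v where "v \<noteq> 0" "1 \<le> cmod v" "w = (v + 1 / v) / 2"
proof -
  define u where "u = w + csqrt (w\<^sup>2 - 1)"
  define u' where "u' = w - csqrt (w\<^sup>2 - 1)"
  have "u * u' = w\<^sup>2 - (csqrt (w\<^sup>2 - 1))\<^sup>2"
    unfolding u_def u'_def by (simp add: power2_eq_square algebra_simps)
  then have prod: "u * u' = 1" by simp
  have sum: "u + u' = 2 * w" by (simp add: u_def u'_def)
  have nz: "u \<noteq> 0" "u' \<noteq> 0" using prod by auto
  have inv: "1 / u = u'" "1 / u' = u" using prod nz by (simp_all add: field_simps)
  have "cmod u * cmod u' = 1" using prod by (metis norm_mult norm_one)
  then have "1 \<le> cmod u \<or> 1 \<le> cmod u'"
    by (smt (verit) mult_left_le_one_le norm_ge_zero mult_le_one nz zero_less_norm_iff mult_less_cancel_left2)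
  then show thesis
  proof
    assume "1 \<le> cmod u" then show thesis using that[of u] nz sum inv by simp
  next
    assume "1 \<le> cmod u'" then show thesis using that[of u'] nz sum inv by (simp add: add.commute)
  qed
qed

text \<open>The real point with preimage \<open>r\<close> has focal distances \<open>Re w - 1\<close> and \<open>Re w + 1\<close>. Leaving the
  real axis makes both strictly larger, and \<open>R \<mapsto> R + 1/R\<close> is increasing for \<open>R \<ge> 1\<close>. In
  particular \<open>|v| > r > 1\<close>, so the limit theorem applies to \<open>v\<close>.\<close>

lemma Joukowski_vertical_shift:
  fixes w :: complex and r :: real
  assumes "1 < r" and Re: "Re w = (r + 1 / r) / 2" and Im: "Im w \<noteq> 0"
  obtains v where "r < cmod v" "w = (v + 1 / v) / 2"
proof -
  obtain v where v: "v \<noteq> 0" "1 \<le> cmod v" "w = (v + 1 / v) / 2"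
    by (rule Joukowski_preimage)
  have strict: "\<bar>Re z\<bar> < cmod z" if "Im z \<noteq> 0" for z
    unfolding cmod_def using that by (intro real_less_rsqrt) simp
  have "Re w - 1 < cmod (w - 1)" "Re w + 1 < cmod (w + 1)"
    using strict[of "w - 1"] strict[of "w + 1"] Im by auto
  moreover have sum_r: "r + 1 / r = 2 * Re w" using Re by simp
  ultimately have "r + 1 / r < cmod v + 1 / cmod v"
    unfolding sum_r using Joukowski_focal_sum[OF v(1,3)] by linarith
  moreover have "(cmod v - r) * (1 - 1 / (r * cmod v)) = (cmod v + 1 / cmod v) - (r + 1 / r)"
    using \<open>1 < r\<close> v(1) by (simp add: field_simps)
  ultimately have "0 < (cmod v - r) * (1 - 1 / (r * cmod v))" by simp
  moreover have "r * 1 \<le> r * cmod v" using \<open>1 < r\<close> v(2) by (intro mult_left_mono) auto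
  then have "1 < r * cmod v" using \<open>1 < r\<close> by linarith
  then have "0 < 1 - 1 / (r * cmod v)" by simp
  ultimately have "r < cmod v" by (simp add: zero_less_mult_iff)
  then show thesis using that v(3) by blast
qed

section \<open>Comparison of the convergence factors\<close>

text \<open>The excluded indices \<open>j = 1\<close> and \<open>j = l/2 + 1\<close> are those with angle \<open>0\<close> and \<open>\<pi>\<close>; all other
  angles lie strictly inside the upper or lower half turn. The modulus \<open>\<alpha>\<^bsup>1/l\<^esup>\<close> is less
  than \<open>m\<close>.\<close>

lemma scaled_root_properties:
  assumes "even l" "l > 2" "0 < \<alpha>" "\<alpha> < m ^ l" "0 < m"
    and j: "j \<in> {2..l div 2} \<union> {l div 2 + 2..l}"
  shows "Im (scaled_root l \<alpha> j) \<noteq> 0" "Re (scaled_root l \<alpha> j) < m"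
proof -
  define \<theta> where "\<theta> = 2 * pi * (real j - 1) / real l"
  define s where "s = \<alpha> powr (1 / real l)"
  have eq: "scaled_root l \<alpha> j = of_real s * cis \<theta>"
    unfolding scaled_root_def s_def \<theta>_def cis_conv_exp by (simp add: mult_ac)
  have s: "0 < s" using \<open>0 < \<alpha>\<close> by (simp add: s_def)
  have "s < (m ^ l) powr (1 / real l)"
    unfolding s_def using assms by (intro powr_less_mono2) auto
  also have "\<dots> = m" using assms by (simp add: powr_powr flip: powr_realpow)
  finally have "s < m" .
  moreover have "s * cos \<theta> \<le> s * 1" using s by (intro mult_left_mono) auto
  ultimately show "Re (scaled_root l \<alpha> j) < m" by (simp add: eq)
  obtain k where k: "l = 2 * k" using \<open>even l\<close> by blast
  have k0: "k > 0" using k \<open>l > 2\<close> by simp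
  define q where "q = (real j - 1) / real k"
  have th: "\<theta> = pi * q" unfolding \<theta>_def q_def k by simp
  have "sin \<theta> \<noteq> 0"
  proof (cases "j \<le> k")
    case True
    then have "2 \<le> j" using j k by auto
    then have "0 < q" "q < 1"
      using True k0 by (auto simp: q_def field_simps)
    then have "0 < \<theta>" "\<theta> < pi" unfolding th by simp_all
    then show ?thesis using sin_gt_zero[of \<theta>] by simp
  next
    case False
    then have "k + 2 \<le> j" "j \<le> 2 * k" using j k by auto
    then have "1 < q" "q < 2"
      using k0 by (auto simp: q_def field_simps)
    then have "pi < \<theta>" "\<theta> < 2 * pi" unfolding th by simp_all
    then show ?thesis using sin_lt_zero[of \<theta>] by simp
  qed
  then show "Im (scaled_root l \<alpha> j) \<noteq> 0" using s by (simp add: eq)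
qed

lemma Re_matrix_shifted: "Re_matrix (shifted A lam) = A - mat (Re lam)"
  by (simp add: Re_matrix_def shifted_def mat_def vec_eq_iff)

theorem theorem4:
  fixes A :: "real^'n^'n" and mu :: "nat \<Rightarrow> real" and \<alpha> :: real and l j N :: nat
    and lam :: complex and B :: "complex^'n^'n" and \<kappa> \<sigma> :: real
  assumes "sym_pos_def A"
    and "N = CARD('n)"
    and "eigenvalues_desc A mu"
    and "mu N > 0" and "mu 1 > mu N"
    and "even l" and "l > 2"
    and "0 < \<alpha>" and "\<alpha> < mu N ^ l"
    and "j \<in> {2..l div 2} \<union> {l div 2 + 2..l}"
    and "lam = scaled_root l \<alpha> j"
    and "B = shifted A lam"
    and "\<kappa> = spectral_cond (Re_matrix B)"
    and "\<sigma> = (sqrt \<kappa> - 1) / (sqrt \<kappa> + 1)"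
  shows "Re_matrix B = A - mat (Re lam)
    \<and> sym_pos_def (Re_matrix B)
    \<and> \<kappa> = (mu 1 - Re lam) / (mu N - Re lam)
    \<and> convergent (conv_seq (of_real (mu N) - lam) (of_real (mu 1) - lam))
    \<and> convergent (conv_seq (of_real (mu N - Re lam)) (of_real (mu 1 - Re lam)))
    \<and> conv_factor (of_real (mu N) - lam) (of_real (mu 1) - lam)
        < conv_factor (of_real (mu N - Re lam)) (of_real (mu 1 - Re lam))
    \<and> conv_factor (of_real (mu N - Re lam)) (of_real (mu 1 - Re lam)) = \<sigma>"
proof -
  define x where "x = Re lam"
  have Im: "Im lam \<noteq> 0" and x: "x < mu N"
    using scaled_root_properties[of l \<alpha> "mu N" j] assms unfolding x_def by auto
  have sym: "transpose A = A" using assms(1) by (simp add: sym_pos_def_def)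
  have ReB: "Re_matrix B = A - mat x" using assms by (simp add: Re_matrix_shifted x_def)
  have spd: "sym_pos_def (Re_matrix B)" and cond: "\<kappa> = (mu 1 - x) / (mu N - x)"
    using eigenvalues_desc_shift[OF sym assms(3), of x] x assms ReB by auto
  have "1 < \<kappa>" using x \<open>mu 1 > mu N\<close> by (simp add: cond)
  define s where "s = sqrt \<kappa>"
  have s: "1 < s" "s\<^sup>2 = \<kappa>" using \<open>1 < \<kappa>\<close> by (simp_all add: s_def)
  define r where "r = (s + 1) / (s - 1)"
  have r: "1 < r" using s by (simp add: r_def field_simps)
  have sigma: "\<sigma> = 1 / r" using assms(14) by (simp add: r_def s_def)
  \<comment> \<open>The real Joukowski argument equals \<open>(\<kappa> + 1)/(\<kappa> - 1)\<close>, and \<open>r\<close> is its preimage.\<close>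
  have "(r + 1 / r) / 2 = (s\<^sup>2 + 1) / (s\<^sup>2 - 1)"
  proof -
    have "s\<^sup>2 - 1 = (s - 1) * (s + 1)" by (simp add: power2_eq_square algebra_simps)
    moreover have "s - 1 \<noteq> 0" "s + 1 \<noteq> 0" using s by auto
    ultimately show ?thesis
      unfolding r_def by (simp add: divide_simps) (simp add: power2_eq_square algebra_simps)
  qed
  also have "\<dots> = (\<kappa> + 1) / (\<kappa> - 1)" by (simp only: s)
  also have "\<dots> = (mu 1 + mu N - 2 * x) / (mu 1 - mu N)"
    unfolding cond using x \<open>mu 1 > mu N\<close> by (simp add: divide_simps)
  finally have centre: "(mu 1 + mu N - 2 * x) / (mu 1 - mu N) = (r + 1 / r) / 2" ..
  let ?a = "of_real (mu N) - lam" and ?b = "of_real (mu 1) - lam"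
  let ?a' = "of_real (mu N - x) :: complex" and ?b' = "of_real (mu 1 - x) :: complex"
  have lim_real: "conv_seq ?a' ?b' \<longlonglongrightarrow> \<sigma>"
  proof -
    have "(?b' + ?a') / (?b' - ?a') = of_real ((mu 1 + mu N - 2 * x) / (mu 1 - mu N))"
      by simp
    also have "\<dots> = (of_real r + 1 / of_real r) / 2" unfolding centre by simp
    finally have "conv_seq ?a' ?b' \<longlonglongrightarrow> 1 / cmod (of_real r)"
      using r \<open>mu 1 > mu N\<close> by (intro conv_seq_LIMSEQ) auto
    then show ?thesis using r by (simp add: sigma)
  qed
  define w where "w = (?b + ?a) / (?b - ?a)"
  have w: "w = (of_real (mu 1 + mu N) - 2 * lam) / of_real (mu 1 - mu N)"
    by (simp add: w_def algebra_simps)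
  have Rew: "Re w = (r + 1 / r) / 2" and Imw: "Im w \<noteq> 0"
    unfolding w Re_divide_of_real Im_divide_of_real centre[symmetric]
    using Im \<open>mu 1 > mu N\<close> by (simp_all add: x_def)
  obtain v where v: "r < cmod v" "w = (v + 1 / v) / 2"
    by (rule Joukowski_vertical_shift[OF r Rew Imw])
  have lim_complex: "conv_seq ?a ?b \<longlonglongrightarrow> 1 / cmod v"
    using v r \<open>mu 1 > mu N\<close> by (intro conv_seq_LIMSEQ) (auto simp: w_def)
  have "1 / cmod v < \<sigma>" unfolding sigma using v(1) r by (intro frac_less2) auto
  moreover have "conv_factor ?a ?b = 1 / cmod v" "conv_factor ?a' ?b' = \<sigma>"
    using lim_complex lim_real unfolding conv_factor_def by (auto intro: limI)
  moreover have "convergent (conv_seq ?a ?b)" "convergent (conv_seq ?a' ?b')"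
    using lim_complex lim_real by (auto simp: convergent_def)
  ultimately show ?thesis using ReB spd cond unfolding x_def by simp
qed

end
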